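(* Let a power grid containing a busbar coupler $s$ (joining two distinct buses) be given, and assume that the grid with open coupler is connected. Let $\boldsymbol B_o$ be the grounded Laplacian of the grid with open coupler, let $\boldsymbol\nu_s=\boldsymbol E\boldsymbol u_s$, and let $\boldsymbol B_c^{-1}=\lim_{b_s\to\infty}(\boldsymbol B_o+b_s\boldsymbol\nu_s\boldsymbol\nu_s^\top)^{-1}$ be the inverse grounded Laplacian of the grid with ideally closed (but not merged) coupler. Then the inverse grounded Laplacian of the grid with open coupler is given by $$\boldsymbol B_o^{-1}=\boldsymbol B_c^{-1}+\Big[\boldsymbol\nu_s^\top\big(\boldsymbol B_o-\boldsymbol B_o\boldsymbol B_c^{-1}\boldsymbol B_o\big)\boldsymbol\nu_s\Big]^{-1}\big(\mathbb 1-\boldsymbol B_c^{-1}\boldsymbol B_o\big)\boldsymbol\nu_s\,\boldsymbol\nu_s^\top\big(\mathbb 1-\boldsymbol B_o\boldsymbol B_c^{-1}\big).$$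
   Context: A grid is a finite graph with buses (nodes) $1,\dots,N_n$ and branches (edges) $1,\dots,N_e$, each branch joining two distinct buses (parallel branches allowed) and carrying a fixed orientation. One bus is chosen as slack bus. The grounded node-edge incidence matrix $\boldsymbol E$ has size $(N_n-1)\times N_e$: $E_{n,e}=+1$ if branch $e$ starts at bus $n$, $-1$ if it ends at $n$, $0$ otherwise, with the row of the slack bus removed. $\boldsymbol u_e$ is the $e$-th standard basis vector of $\mathbb R^{N_e}$ and $\boldsymbol\nu_e=\boldsymbol E\boldsymbol u_e$. $\mathbb 1$ is the identity matrix. One of the branches is the busbar coupler $s$, also included as a column of $\boldsymbol E$. All branches $e\neq s$ have susceptance $b_e>0$. The coupler has susceptance $b_s=0$ when open and $b_s\to\infty$ when closed. Let $\mathfrak B_o$ be the diagonal matrix with entries $b_e$ for $e\ne s$ and $0$ for $e=s$. The grounded Laplacian of the open grid is $\boldsymbol B_o=\boldsymbol E\,\mathfrak B_o\boldsymbol E^\top$; "connected with open coupler" means that the graph with all branches $e\neq s$ is connected, so that $\boldsymbol B_o$ is invertible. For finite $b_s>0$ the grounded Laplacian of the closed (not merged) grid is $\boldsymbol B_o+b_s\boldsymbol\nu_s\boldsymbol\nu_s^\top$. The symbol $\boldsymbol B_c^{-1}$ denotes the entrywise limit of its inverse as $b_s\to\infty$ (this limit is a singular matrix, so the symbol is notation and not the inverse of a matrix). *)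

theory Defs
  imports
    Complex_Main
    "Jordan_Normal_Form.Determinant"
    "Jordan_Normal_Form.Gauss_Jordan_Elimination"
    "Graph_Theory.Digraph_Component"
begin

text \<open>
  Buses and branches are numbered from 0, and a branch \<open>e\<close> is oriented from \<open>tail G e\<close> to
  \<open>head G e\<close>. Parallel branches are allowed, loops are not. The value \<open>b s\<close> is unconstrained:
  the susceptance of the coupler \<open>s\<close> is always supplied separately.
\<close>

locale power_grid = loopfree_digraph G
  for G :: "(nat, nat) pre_digraph" +
  fixes Nn Ne slack s :: nat
    and b :: "nat \<Rightarrow> real"
  assumes verts_eq: "verts G = {..<Nn}"
    and arcs_eq: "arcs G = {..<Ne}"
    and slack_bus: "slack \<in> verts G"
    and coupler: "s \<in> arcs G"
    and susceptance_pos: "\<And>e. e \<in> arcs G \<Longrightarrow> e \<noteq> s \<Longrightarrow> b e > 0"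

text \<open>
  The underlying undirected graph is considered. The constant is qualified because
  topological connectedness has the same base name.
\<close>

definition connected_open :: "(nat, nat) pre_digraph \<Rightarrow> nat \<Rightarrow> bool" where
  "connected_open G s \<longleftrightarrow> Digraph_Component.connected (pre_digraph.del_arc G s)"

definition incidence :: "(nat, nat) pre_digraph \<Rightarrow> nat \<Rightarrow> nat \<Rightarrow> real mat" where
  "incidence G Nn Ne = mat Nn Ne (\<lambda>(n, e).
     if tail G e = n then 1 else if head G e = n then -1 else 0)"

text \<open>\<open>insert_index slack\<close> enumerates the buses other than \<open>slack\<close> in increasing order.\<close>

definition grounded_incidence ::
    "(nat, nat) pre_digraph \<Rightarrow> nat \<Rightarrow> nat \<Rightarrow> nat \<Rightarrow> real mat" where
  "grounded_incidence G Nn Ne slack = mat (Nn - 1) Ne (\<lambda>(i, e).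
     incidence G Nn Ne $$ (insert_index slack i, e))"

definition open_susceptance :: "nat \<Rightarrow> nat \<Rightarrow> (nat \<Rightarrow> real) \<Rightarrow> real mat" where
  "open_susceptance Ne s b = mat_diag Ne (\<lambda>e. if e = s then 0 else b e)"

definition open_laplacian ::
    "(nat, nat) pre_digraph \<Rightarrow> nat \<Rightarrow> nat \<Rightarrow> nat \<Rightarrow> nat \<Rightarrow> (nat \<Rightarrow> real) \<Rightarrow> real mat" where
  "open_laplacian G Nn Ne slack s b =
     (let E = grounded_incidence G Nn Ne slack
      in E * open_susceptance Ne s b * transpose_mat E)"

definition branch_vec ::
    "(nat, nat) pre_digraph \<Rightarrow> nat \<Rightarrow> nat \<Rightarrow> nat \<Rightarrow> nat \<Rightarrow> real vec" where
  "branch_vec G Nn Ne slack e = grounded_incidence G Nn Ne slack *\<^sub>v unit_vec Ne e"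

definition outer :: "real vec \<Rightarrow> real vec \<Rightarrow> real mat" where
  "outer v w = mat (dim_vec v) (dim_vec w) (\<lambda>(i, j). v $ i * w $ j)"

text \<open>Only meaningful for invertible square matrices.\<close>

definition mat_inv :: "real mat \<Rightarrow> real mat" where
  "mat_inv A = the (mat_inverse A)"

definition closed_laplacian ::
    "(nat, nat) pre_digraph \<Rightarrow> nat \<Rightarrow> nat \<Rightarrow> nat \<Rightarrow> nat \<Rightarrow> (nat \<Rightarrow> real) \<Rightarrow> real \<Rightarrow> real mat" where
  "closed_laplacian G Nn Ne slack s b bs =
     open_laplacian G Nn Ne slack s b +
     bs \<cdot>\<^sub>m outer (branch_vec G Nn Ne slack s) (branch_vec G Nn Ne slack s)"

text \<open>
  The entrywise limit for an ideally closed coupler. It is a singular matrix, so it is not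
  itself the inverse of a matrix. \<open>Lim\<close> is only meaningful where the limit exists.
\<close>

definition closed_inverse ::
    "(nat, nat) pre_digraph \<Rightarrow> nat \<Rightarrow> nat \<Rightarrow> nat \<Rightarrow> nat \<Rightarrow> (nat \<Rightarrow> real) \<Rightarrow> real mat" where
  "closed_inverse G Nn Ne slack s b = mat (Nn - 1) (Nn - 1) (\<lambda>(i, j).
     Lim at_top (\<lambda>bs. mat_inv (closed_laplacian G Nn Ne slack s b bs) $$ (i, j)))"

end

(*
  The open Laplacian A is positive definite: its quadratic form is a positively weighted sum of
  squared potential differences, so it vanishes only for a potential that is constant along all
  branches but s, and connectedness propagates the value 0 from the slack bus.
  With M = A^-1, w = M v and q = v.w > 0, the Sherman-Morrison formula gives
  (A + t v v^T)^-1 = M - t / (1 + t q) w w^T, which tends to C = M - w w^T / q.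
  Since A w = v, one gets 1 - C A = w v^T / q and A - A C A = v v^T / q, so the rank-one
  correction in the claim is exactly w w^T / q = M - C.
*)

theory Submission
  imports Defs
begin

section \<open>Outer products and matrix inverses\<close>

lemma outer_carrier [simp]:
  "v \<in> carrier_vec n \<Longrightarrow> w \<in> carrier_vec m \<Longrightarrow> outer v w \<in> carrier_mat n m"
  by (auto simp: outer_def)

lemma dim_outer [simp]: "dim_row (outer v w) = dim_vec v" "dim_col (outer v w) = dim_vec w"
  by (auto simp: outer_def)

lemma index_outer [simp]:
  "i < dim_vec v \<Longrightarrow> j < dim_vec w \<Longrightarrow> outer v w $$ (i, j) = v $ i * w $ j"
  by (auto simp: outer_def)

lemma mult_outer:
  assumes "A \<in> carrier_mat n m" "v \<in> carrier_vec m"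
  shows "A * outer v w = outer (A *\<^sub>v v) w"
  using assms by (intro eq_matI) (auto simp: outer_def scalar_prod_def sum_distrib_right mult.assoc)

lemma outer_mult:
  assumes "A \<in> carrier_mat m n" "w \<in> carrier_vec m"
  shows "outer v w * A = outer v (transpose_mat A *\<^sub>v w)"
  using assms
  by (intro eq_matI) (auto simp: outer_def scalar_prod_def sum_distrib_left mult_ac)

lemma outer_mult_vec:
  assumes "x \<in> carrier_vec (dim_vec w)"
  shows "outer v w *\<^sub>v x = (w \<bullet> x) \<cdot>\<^sub>v v"
  using assms
  by (intro eq_vecI) (auto simp: outer_def scalar_prod_def sum_distrib_left mult_ac)

lemma outer_mult_outer:
  assumes "x \<in> carrier_vec (dim_vec w)"
  shows "outer v w * outer x y = (w \<bullet> x) \<cdot>\<^sub>m outer v y"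
proof -
  have "outer v w * outer x y = outer ((w \<bullet> x) \<cdot>\<^sub>v v) y"
    using assms by (subst mult_outer) (auto simp: outer_mult_vec)
  also have "\<dots> = (w \<bullet> x) \<cdot>\<^sub>m outer v y"
    by (intro eq_matI) auto
  finally show ?thesis .
qed

lemma smult_mat_mult_vec:
  "x \<in> carrier_vec (dim_col A) \<Longrightarrow> (k \<cdot>\<^sub>m A) *\<^sub>v x = k \<cdot>\<^sub>v (A *\<^sub>v (x :: real vec))"
  by (intro eq_vecI) (auto simp: smult_scalar_prod_distrib[of _ "dim_col A"])

lemma smult_smult_mat: "a \<cdot>\<^sub>m (b \<cdot>\<^sub>m A) = (a * b :: real) \<cdot>\<^sub>m A"
  by (intro eq_matI) auto

text \<open>A non-zero determinant makes \<open>A\<close> a unit of the matrix ring, so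
  \<open>mat_inverse\<close> cannot return \<open>None\<close> and the \<open>the\<close> in
  \<open>mat_inv\<close> is harmless.\<close>

lemma mat_inv_mult:
  assumes "A \<in> carrier_mat n n" "det A \<noteq> 0"
  shows "mat_inv A \<in> carrier_mat n n" "A * mat_inv A = 1\<^sub>m n" "mat_inv A * A = 1\<^sub>m n"
proof -
  have "A \<in> Units (ring_mat TYPE(real) n undefined)"
    by (rule det_non_zero_imp_unit[OF assms])
  then obtain B where "mat_inverse A = Some B"
    using mat_inverse(1)[OF assms(1)] by (metis option.exhaust)
  then show "mat_inv A \<in> carrier_mat n n" "A * mat_inv A = 1\<^sub>m n" "mat_inv A * A = 1\<^sub>m n"
    using mat_inverse(2)[OF assms(1)] by (auto simp: mat_inv_def)
qed

text \<open>A right inverse suffices: the determinants multiply to 1, so \<open>A\<close> is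
  nonsingular, and its left inverse cancels \<open>A\<close> from \<open>A * B\<close>.\<close>

lemma mat_inv_eqI:
  assumes "A \<in> carrier_mat n n" "B \<in> carrier_mat n n" "A * B = 1\<^sub>m n"
  shows "mat_inv A = B"
proof -
  have "det A * det B = 1"
    using assms by (metis det_mult det_one)
  then have "det A \<noteq> 0" by auto
  note inv = mat_inv_mult[OF assms(1) this]
  have "mat_inv A = mat_inv A * (A * B)"
    using assms inv by simp
  also have "\<dots> = mat_inv A * A * B"
    by (rule assoc_mult_mat[symmetric]) (use assms inv in auto)
  also have "\<dots> = B" using assms inv by simp
  finally show ?thesis .
qed

section \<open>Invertibility and positive definiteness\<close>

lemma invertible_mat_det:
  assumes "A \<in> carrier_mat n n" "det (A :: real mat) \<noteq> 0"
  shows "invertible_mat A"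
  using mat_inv_mult[OF assms] assms
  by (auto simp: invertible_mat_def inverts_mat_def intro!: exI[of _ "mat_inv A"])

text \<open>Symmetry is kept apart; the locale \<open>sym_pos_def\<close> assumes it
  separately.\<close>

definition pos_def :: "nat \<Rightarrow> real mat \<Rightarrow> bool" where
  "pos_def n A \<longleftrightarrow> A \<in> carrier_mat n n \<and>
     (\<forall>x\<in>carrier_vec n. x \<noteq> 0\<^sub>v n \<longrightarrow> 0 < x \<bullet> (A *\<^sub>v x))"

text \<open>A non-zero kernel vector of a singular matrix would make the quadratic form
  vanish.\<close>

lemma pos_def_det:
  assumes "pos_def n A"
  shows "det A \<noteq> 0"
proof
  assume "det A = 0"
  then obtain x where "x \<in> carrier_vec n" "x \<noteq> 0\<^sub>v n" "A *\<^sub>v x = 0\<^sub>v n"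
    using assms det_0_iff_vec_prod_zero_field[of A n] by (auto simp: pos_def_def)
  with assms show False by (force simp: pos_def_def)
qed

text \<open>The rank-one term contributes \<open>t\<close> times the square of
  \<open>v \<bullet> x\<close> to the form. This yields invertibility of the closed Laplacian for
  every finite coupler susceptance.\<close>

lemma pos_def_add_outer:
  assumes A: "pos_def n A" and v: "v \<in> carrier_vec n" and t: "0 \<le> t"
  shows "pos_def n (A + t \<cdot>\<^sub>m outer v v)"
  unfolding pos_def_def
proof (intro conjI ballI impI)
  have Ac: "A \<in> carrier_mat n n" using A by (simp add: pos_def_def)
  then show "A + t \<cdot>\<^sub>m outer v v \<in> carrier_mat n n" using v by auto
  fix x :: "real vec" assume x: "x \<in> carrier_vec n" "x \<noteq> 0\<^sub>v n"
  have "(A + t \<cdot>\<^sub>m outer v v) *\<^sub>v x = A *\<^sub>v x + (t * (v \<bullet> x)) \<cdot>\<^sub>v v"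
    using Ac v x by (simp add: add_mult_distrib_mat_vec[of _ n n] outer_mult_vec
        smult_mat_mult_vec smult_smult_assoc)
  then have "x \<bullet> ((A + t \<cdot>\<^sub>m outer v v) *\<^sub>v x) = x \<bullet> (A *\<^sub>v x) + t * (v \<bullet> x)\<^sup>2"
    using Ac v x comm_scalar_prod[of x n v]
    by (simp add: scalar_prod_add_distrib[of _ n] power2_eq_square)
  moreover have "0 < x \<bullet> (A *\<^sub>v x)" using A x by (auto simp: pos_def_def)
  ultimately show "0 < x \<bullet> ((A + t \<cdot>\<^sub>m outer v v) *\<^sub>v x)"
    using t by (simp add: add_pos_nonneg)
qed

lemma scalar_prod_transpose:
  assumes "A \<in> carrier_mat n m" "x \<in> carrier_vec n" "y \<in> carrier_vec m"
  shows "x \<bullet> (A *\<^sub>v y) = (transpose_mat A *\<^sub>v x) \<bullet> (y :: real vec)"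
  using transpose_vec_mult_scalar[OF assms(1,3,2)] comm_scalar_prod[of x n] assms by simp

section \<open>Rank-one update of a symmetric positive definite matrix\<close>

locale sym_pos_def =
  fixes n :: nat and A :: "real mat" and v :: "real vec"
  assumes pos_def: "pos_def n A"
    and sym: "transpose_mat A = A"
    and v: "v \<in> carrier_vec n" "v \<noteq> 0\<^sub>v n"
begin

definition "M = mat_inv A"
text \<open>With \<open>A\<close> the open Laplacian and \<open>v\<close> the coupler column,
  \<open>w\<close> lists the bus potentials when one unit is injected at one end of the coupler and
  withdrawn at the other. Then \<open>q\<close> is the effective resistance between these ends in
  the open grid.\<close>

definition "w = M *\<^sub>v v"
definition "q = v \<bullet> w"

lemma A_carrier: "A \<in> carrier_mat n n" using pos_def by (simp add: pos_def_def)

lemma M_carrier: "M \<in> carrier_mat n n" and AM: "A * M = 1\<^sub>m n" and MA: "M * A = 1\<^sub>m n"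
  using mat_inv_mult[OF A_carrier pos_def_det[OF pos_def]] by (auto simp: M_def)

lemma w_carrier: "w \<in> carrier_vec n" using M_carrier v by (auto simp: w_def)

lemma Aw: "A *\<^sub>v w = v"
proof -
  have "A *\<^sub>v w = (A * M) *\<^sub>v v"
    unfolding w_def by (rule assoc_mult_mat_vec[symmetric, OF A_carrier M_carrier v(1)])
  then show ?thesis using AM v by simp
qed

text \<open>Transposing \<open>M * A = 1\<close> shows that the transpose of \<open>M\<close> is a
  right inverse of \<open>A\<close> too; inverses are unique.\<close>

lemma sym_M: "transpose_mat M = M"
proof -
  have "A * transpose_mat M = 1\<^sub>m n"
    using transpose_mult[OF M_carrier A_carrier] MA sym by simp
  then show ?thesis
    using mat_inv_eqI[OF A_carrier, of "transpose_mat M"] M_carrier by (simp add: M_def)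
qed

text \<open>Since \<open>A\<close> maps \<open>w\<close> to \<open>v\<close>, \<open>q\<close> is
  the quadratic form of \<open>A\<close> at \<open>w\<close>, and \<open>w\<close> is non-zero
  because \<open>v\<close> is.\<close>

lemma q_pos: "q > 0"
proof -
  have "A *\<^sub>v 0\<^sub>v n = 0\<^sub>v n" using A_carrier by (intro eq_vecI) auto
  then have "w \<noteq> 0\<^sub>v n" using Aw v(2) by metis
  then have "0 < w \<bullet> v" using pos_def w_carrier Aw by (auto simp: pos_def_def)
  then show ?thesis using comm_scalar_prod[OF w_carrier v(1)] by (simp add: q_def)
qed

lemma sherman_morrison:
  assumes "t \<ge> 0"
  shows "mat_inv (A + t \<cdot>\<^sub>m outer v v) = M - (t / (1 + t * q)) \<cdot>\<^sub>m outer w w"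
proof (rule mat_inv_eqI)
  let ?c = "t / (1 + t * q)"
  \<comment> \<open>The denominator is at least 1, since \<open>t\<close> is nonnegative and
    \<open>q\<close> positive.\<close>
  have nz: "1 + t * q \<noteq> 0" using assms q_pos by (smt (verit) mult_nonneg_nonneg)
  show "A + t \<cdot>\<^sub>m outer v v \<in> carrier_mat n n" using A_carrier v by auto
  show "M - ?c \<cdot>\<^sub>m outer w w \<in> carrier_mat n n" using M_carrier w_carrier by auto
  have "(A + t \<cdot>\<^sub>m outer v v) * (M - ?c \<cdot>\<^sub>m outer w w)
      = (A + t \<cdot>\<^sub>m outer v v) * M - ?c \<cdot>\<^sub>m ((A + t \<cdot>\<^sub>m outer v v) * outer w w)"
    using A_carrier M_carrier v w_carrier by (subst mult_minus_distrib_mat[of _ n n _ n]) (auto simp: mult_smult_distrib[of _ n n _ n])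
  also have "(A + t \<cdot>\<^sub>m outer v v) * M = 1\<^sub>m n + t \<cdot>\<^sub>m outer v w"
    using A_carrier M_carrier v AM sym_M by (simp add: add_mult_distrib_mat[of _ n n _ _ n] outer_mult[of _ n n] w_def
        mult_smult_assoc_mat[of _ n n _ n])
  also have "(A + t \<cdot>\<^sub>m outer v v) * outer w w = outer v w + (t * q) \<cdot>\<^sub>m outer v w"
    using A_carrier v w_carrier Aw by (simp add: add_mult_distrib_mat[of _ n n _ _ n] mult_outer[of A n n]
        mult_smult_assoc_mat[of _ n n _ n] outer_mult_outer q_def[symmetric] smult_smult_mat)
  \<comment> \<open>All corrections are multiples of \<open>outer v w\<close>; the coefficient
    \<open>t - ?c * (1 + t * q)\<close> vanishes by the choice of \<open>?c\<close>.\<close>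
  also have "1\<^sub>m n + t \<cdot>\<^sub>m outer v w - ?c \<cdot>\<^sub>m (outer v w + (t * q) \<cdot>\<^sub>m outer v w) = 1\<^sub>m n"
    using v w_carrier nz by (intro eq_matI) (auto simp: field_simps)
  finally show "(A + t \<cdot>\<^sub>m outer v v) * (M - ?c \<cdot>\<^sub>m outer w w) = 1\<^sub>m n" .
qed

text \<open>The limit of the Sherman-Morrison formula, as \<open>t / (1 + t * q)\<close> tends to
  \<open>1 / q\<close>. It maps \<open>v\<close> to \<open>w - w = 0\<close>, hence is
  singular.\<close>

definition "C = M - (1 / q) \<cdot>\<^sub>m outer w w"

lemma C_carrier: "C \<in> carrier_mat n n" using M_carrier w_carrier by (auto simp: C_def)

lemma closed_limit:
  assumes "i < n" "j < n"
  shows "((\<lambda>t. mat_inv (A + t \<cdot>\<^sub>m outer v v) $$ (i, j)) \<longlongrightarrow> C $$ (i, j)) at_top"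
proof -
  \<comment> \<open>For positive \<open>t\<close>, dividing numerator and denominator by
    \<open>t\<close> exposes the limit.\<close>
  have "((\<lambda>t. t / (1 + t * q)) \<longlongrightarrow> 1 / q) at_top"
  proof (rule Lim_transform_eventually)
    show "((\<lambda>t::real. 1 / (inverse t + q)) \<longlongrightarrow> 1 / q) at_top"
      using q_pos tendsto_divide[OF tendsto_const tendsto_add[OF tendsto_inverse_0_at_top[OF filterlim_ident] tendsto_const], of q 1]
      by simp
    show "\<forall>\<^sub>F t in at_top. 1 / (inverse t + q) = t / (1 + t * q)"
      using eventually_gt_at_top[of 0]
      by eventually_elim (use q_pos in \<open>simp add: field_simps\<close>)
  qed
  then have "((\<lambda>t. M $$ (i, j) - t / (1 + t * q) * (w $ i * w $ j))
      \<longlongrightarrow> M $$ (i, j) - 1 / q * (w $ i * w $ j)) at_top"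
    by (intro tendsto_diff tendsto_mult tendsto_const)
  moreover have "C $$ (i, j) = M $$ (i, j) - 1 / q * (w $ i * w $ j)"
    using assms M_carrier w_carrier by (simp add: C_def)
  moreover have "\<forall>\<^sub>F t in at_top. M $$ (i, j) - t / (1 + t * q) * (w $ i * w $ j)
      = mat_inv (A + t \<cdot>\<^sub>m outer v v) $$ (i, j)"
    using eventually_ge_at_top[of 0]
    by eventually_elim (use assms M_carrier w_carrier in \<open>simp add: sherman_morrison\<close>)
  ultimately show ?thesis by (simp only: Lim_transform_eventually)
qed

text \<open>By symmetry of \<open>A\<close>, multiplying \<open>outer w w\<close> by
  \<open>A\<close> from the right turns the second factor into \<open>A *\<^sub>v w\<close>, which
  is \<open>v\<close>.\<close>

lemma CA: "C * A = 1\<^sub>m n - (1 / q) \<cdot>\<^sub>m outer w v"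
  using A_carrier M_carrier w_carrier sym Aw MA unfolding C_def
  by (subst minus_mult_distrib_mat[of _ n n _ _ n])
    (auto simp: mult_smult_assoc_mat[of _ n n _ n] outer_mult[of A n n])

lemma AC: "A * C = 1\<^sub>m n - (1 / q) \<cdot>\<^sub>m outer v w"
  using A_carrier M_carrier w_carrier Aw AM unfolding C_def
  by (subst mult_minus_distrib_mat[of _ n n _ n])
    (auto simp: mult_smult_distrib[of _ n n _ n] mult_outer[of A n n])

lemma ACA: "A - A * C * A = (1 / q) \<cdot>\<^sub>m outer v v"
proof -
  have "A * C * A = A - (1 / q) \<cdot>\<^sub>m outer v v"
    using A_carrier v w_carrier sym Aw unfolding AC
    by (subst minus_mult_distrib_mat[of _ n n _ _ n])
      (auto simp: mult_smult_assoc_mat[of _ n n _ n] outer_mult[of A n n])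
  then show ?thesis using A_carrier v by (auto intro!: eq_matI)
qed

lemma vv_pos: "v \<bullet> v > 0"
  using v conjugate_square_greater_0_vec[of v n] by simp

lemma denominator: "v \<bullet> ((A - A * C * A) *\<^sub>v v) = (v \<bullet> v)\<^sup>2 / q"
  using v unfolding ACA
  by (simp add: smult_mat_mult_vec outer_mult_vec power2_eq_square)

text \<open>Both outer factors have rank one by \<open>CA\<close> and \<open>AC\<close>. In the
  chain of three outer products each of the two junctions yields \<open>v \<bullet> v\<close>, and
  each outer factor a \<open>1 / q\<close>.\<close>

lemma numerator:
  "(1\<^sub>m n - C * A) * outer v v * (1\<^sub>m n - A * C) = ((v \<bullet> v)\<^sup>2 / q\<^sup>2) \<cdot>\<^sub>m outer w w"
proof -
  have "1\<^sub>m n - C * A = (1 / q) \<cdot>\<^sub>m outer w v" "1\<^sub>m n - A * C = (1 / q) \<cdot>\<^sub>m outer v w"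
    using v w_carrier unfolding CA AC by (auto intro!: eq_matI)
  moreover have "(1 / q) \<cdot>\<^sub>m outer w v * outer v v * ((1 / q) \<cdot>\<^sub>m outer v w)
      = (1 / q * (v \<bullet> v) * (1 / q) * (v \<bullet> v)) \<cdot>\<^sub>m outer w w"
    using v w_carrier by (subst mult_smult_distrib[of _ n n _ n])
      (auto simp: mult_smult_assoc_mat[of _ n n _ n] outer_mult_outer smult_smult_mat ac_simps)
  ultimately show ?thesis by (simp add: power2_eq_square)
qed

text \<open>The powers of \<open>v \<bullet> v\<close> cancel between \<open>numerator\<close> and
  \<open>denominator\<close>, leaving \<open>1 / q\<close> times \<open>outer w w\<close>, precisely
  what was subtracted from \<open>M\<close> to form \<open>C\<close>.\<close>

lemma inverse_eq:
  "mat_inv A = C + inverse (v \<bullet> ((A - A * C * A) *\<^sub>v v)) \<cdot>\<^sub>m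
     ((1\<^sub>m n - C * A) * outer v v * (1\<^sub>m n - A * C))"
  unfolding denominator numerator M_def[symmetric]
  using M_carrier w_carrier q_pos vv_pos by (intro eq_matI) (auto simp: C_def power2_eq_square)

end

section \<open>The grounded Laplacian of the grid\<close>

context power_grid
begin

text \<open>Extends a grounded vector to all buses by the value 0 at the slack bus, so that later
  arguments need not single out branches at the slack bus.\<close>

definition potential :: "real vec \<Rightarrow> nat \<Rightarrow> real" where
  "potential x k = (if k = slack then 0 else x $ delete_index slack k)"

abbreviation "E \<equiv> grounded_incidence G Nn Ne slack"

lemma E_carrier: "E \<in> carrier_mat (Nn - 1) Ne"
  by (simp add: grounded_incidence_def)

lemma slack_less: "slack < Nn"
  using slack_bus verts_eq by auto

lemma arc_ends:
  assumes "e < Ne"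
  shows "tail G e < Nn" "head G e < Nn" "tail G e \<noteq> head G e"
  using assms arcs_eq verts_eq tail_in_verts[of e] head_in_verts[of e] no_loops[of e] by auto

lemma insert_index_less: "i < Nn - 1 \<Longrightarrow> insert_index slack i < Nn"
  by (auto simp: insert_index_def)

text \<open>As a branch has distinct ends, the nested conditional of \<open>incidence\<close> is a
  difference of two indicators, which splits sums over the buses.\<close>

lemma index_E:
  assumes "i < Nn - 1" "e < Ne"
  shows "E $$ (i, e) = (if insert_index slack i = tail G e then 1 else 0)
    - (if insert_index slack i = head G e then 1 else 0)"
  using assms arc_ends[OF assms(2)] insert_index_less[OF assms(1)]
  by (auto simp: grounded_incidence_def incidence_def)

lemma insert_index_eq_iff:
  "insert_index slack i = k \<longleftrightarrow> k \<noteq> slack \<and> i = delete_index slack k"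
proof -
  have "insert_index slack i \<noteq> slack" by (auto simp: insert_index_def)
  then show ?thesis by (metis delete_insert_index insert_delete_index)
qed

lemma delete_index_less: "k < Nn \<Longrightarrow> k \<noteq> slack \<Longrightarrow> delete_index slack k < Nn - 1"
  using slack_less by (auto simp: delete_index_def)

text \<open>For the slack bus no index matches and the sum is 0, the grounded potential; any other
  bus is hit by exactly one index.\<close>

lemma sum_potential:
  assumes "k < Nn"
  shows "(\<Sum>i<Nn - 1. (if insert_index slack i = k then 1 else 0) * x $ i) = potential x k"
proof (cases "k = slack")
  case True
  then show ?thesis by (simp add: insert_index_eq_iff potential_def)
next
  case False
  then have "(\<Sum>i<Nn - 1. (if insert_index slack i = k then 1 else 0) * x $ i)
      = (\<Sum>i<Nn - 1. if delete_index slack k = i then x $ i else 0)"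
    by (intro sum.cong) (auto simp: insert_index_eq_iff)
  then show ?thesis using delete_index_less[OF assms False] False by (simp add: potential_def)
qed

lemma transpose_E_mult:
  assumes "x \<in> carrier_vec (Nn - 1)" "e < Ne"
  shows "(transpose_mat E *\<^sub>v x) $ e = potential x (tail G e) - potential x (head G e)"
proof -
  have "(transpose_mat E *\<^sub>v x) $ e = (\<Sum>i<Nn - 1. E $$ (i, e) * x $ i)"
    using assms E_carrier by (auto simp: scalar_prod_def atLeast0LessThan intro!: sum.cong)
  also have "\<dots> = potential x (tail G e) - potential x (head G e)"
    using assms arc_ends[OF assms(2)]
    by (simp add: index_E left_diff_distrib sum_subtractf sum_potential del: One_nat_def)
  finally show ?thesis .
qed

lemma open_susceptance_carrier: "open_susceptance Ne s b \<in> carrier_mat Ne Ne"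
  by (simp add: open_susceptance_def mat_diag_def)

lemma open_laplacian_carrier:
  "open_laplacian G Nn Ne slack s b \<in> carrier_mat (Nn - 1) (Nn - 1)"
  using E_carrier by (auto simp: open_laplacian_def Let_def)

lemma transpose_open_laplacian:
  "transpose_mat (open_laplacian G Nn Ne slack s b) = open_laplacian G Nn Ne slack s b"
proof -
  let ?D = "open_susceptance Ne s b"
  have [simp]: "transpose_mat ?D = ?D"
    by (auto simp: open_susceptance_def mat_diag_def intro!: eq_matI)
  note D = open_susceptance_carrier
  have "transpose_mat (E * ?D * transpose_mat E) = E * (?D * transpose_mat E)"
    using transpose_mult[of "E * ?D" "Nn - 1" Ne "transpose_mat E" "Nn - 1"]
      transpose_mult[OF E_carrier D] E_carrier D by simp
  also have "\<dots> = E * ?D * transpose_mat E"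
    using E_carrier D by (intro assoc_mult_mat[symmetric]) auto
  finally show ?thesis by (simp add: open_laplacian_def Let_def)
qed

text \<open>Moving \<open>E\<close> to the left factor gives the diagonal form at
  \<open>transpose_mat E *\<^sub>v x\<close>, whose entries are the potential differences along the
  branches.\<close>

lemma open_laplacian_form:
  assumes x: "x \<in> carrier_vec (Nn - 1)"
  shows "x \<bullet> (open_laplacian G Nn Ne slack s b *\<^sub>v x)
    = (\<Sum>e<Ne. (if e = s then 0 else b e) * (potential x (tail G e) - potential x (head G e))\<^sup>2)"
proof -
  let ?D = "open_susceptance Ne s b" and ?y = "transpose_mat E *\<^sub>v x"
  note D = open_susceptance_carrier
  have y: "?y \<in> carrier_vec Ne" using E_carrier by (metis carrier_vec_dim_vec carrier_matD(2) dim_mult_mat_vec index_transpose_mat(2))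
  have "open_laplacian G Nn Ne slack s b *\<^sub>v x = E *\<^sub>v (?D *\<^sub>v ?y)"
    using E_carrier D x y by (simp add: open_laplacian_def Let_def
        assoc_mult_mat_vec[of _ "Nn - 1" Ne _ "Nn - 1"] assoc_mult_mat_vec[of _ "Nn - 1" Ne _ Ne])
  then have "x \<bullet> (open_laplacian G Nn Ne slack s b *\<^sub>v x) = ?y \<bullet> (?D *\<^sub>v ?y)"
    using E_carrier D x y by (simp add: scalar_prod_transpose[of _ "Nn - 1" Ne])
  also have "?D *\<^sub>v ?y = vec Ne (\<lambda>e. (if e = s then 0 else b e) * ?y $ e)"
    using y E_carrier by (intro eq_vecI)
      (auto simp: open_susceptance_def mat_diag_def scalar_prod_def if_distrib[of "\<lambda>z. z * _"] cong: if_cong)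
  also have "?y \<bullet> \<dots> = (\<Sum>e<Ne. (if e = s then 0 else b e) * (?y $ e)\<^sup>2)"
    by (auto simp: scalar_prod_def atLeast0LessThan power2_eq_square intro!: sum.cong)
  finally show ?thesis using x by (simp add: transpose_E_mult)
qed

lemma pos_def_open_laplacian:
  assumes conn: "connected_open G s"
  shows "pos_def (Nn - 1) (open_laplacian G Nn Ne slack s b)"
  unfolding pos_def_def
proof (intro conjI ballI impI)
  show "open_laplacian G Nn Ne slack s b \<in> carrier_mat (Nn - 1) (Nn - 1)"
    by (rule open_laplacian_carrier)
  fix x :: "real vec" assume x: "x \<in> carrier_vec (Nn - 1)" "x \<noteq> 0\<^sub>v (Nn - 1)"
  let ?f = "\<lambda>e. (if e = s then 0 else b e) * (potential x (tail G e) - potential x (head G e))\<^sup>2"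
  have nonneg: "0 \<le> ?f e" if "e < Ne" for e
    using that susceptance_pos[of e] arcs_eq by (simp add: less_imp_le)
  have "sum ?f {..<Ne} \<noteq> 0"
  proof
    assume "sum ?f {..<Ne} = 0"
    then have "?f e = 0" if "e < Ne" for e
      using that nonneg by (subst (asm) sum_nonneg_eq_0_iff) auto
    \<comment> \<open>Away from \<open>s\<close> the weight is positive, so the squared difference
      itself must vanish.\<close>
    then have eq: "potential x (tail G e) = potential x (head G e)" if "e < Ne" "e \<noteq> s" for e
      using that susceptance_pos[of e] arcs_eq by fastforce
    \<comment> \<open>Every arc of the symmetrized graph is a branch other than \<open>s\<close> in
      one of its two directions, and equality of potentials ignores direction.\<close>
    have adj: "potential x k = potential x l"
      if "(k, l) \<in> arcs_ends (mk_symmetric (del_arc s))" for k l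
      using that eq arcs_eq by (auto simp: mk_symmetric_def arcs_ends_def arc_to_ends_def)
    have const: "potential x k = potential x l"
      if "(k, l) \<in> rtrancl_on V (arcs_ends (mk_symmetric (del_arc s)))" for k l V
      using that
    proof (induction rule: rtrancl_on_induct)
      case (step y z)
      then show ?case using adj[of y z] by metis
    qed simp
    have "potential x k = 0" if "k < Nn" for k
    proof -
      \<comment> \<open>Connectedness is strong connectedness of the symmetrized graph, so the slack
        bus reaches every bus.\<close>
      have "slack \<rightarrow>\<^sup>*\<^bsub>mk_symmetric (del_arc s)\<^esub> k"
        using conn that slack_less verts_eq
        by (auto simp: connected_open_def Digraph_Component.connected_def
            strongly_connected_def mk_symmetric_def)
      then have "potential x slack = potential x k"
        unfolding reachable_def by (rule const)
      then show ?thesis by (simp add: potential_def)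
    qed
    \<comment> \<open>Entry \<open>i\<close> of \<open>x\<close> is the potential of the non-slack
      bus \<open>insert_index slack i\<close>.\<close>
    then have "x $ i = 0" if "i < Nn - 1" for i
      using insert_index_less[OF that] insert_index_eq_iff[of i "insert_index slack i"]
      by (metis potential_def)
    with x show False by (auto intro: eq_vecI)
  qed
  moreover have "sum ?f {..<Ne} \<ge> 0" using nonneg by (intro sum_nonneg) auto
  ultimately show "0 < x \<bullet> (open_laplacian G Nn Ne slack s b *\<^sub>v x)"
    using open_laplacian_form[OF x(1)] by simp
qed

lemma branch_vec_carrier: "branch_vec G Nn Ne slack e \<in> carrier_vec (Nn - 1)"
  using E_carrier by (auto simp: branch_vec_def)

text \<open>Grounding deletes a single row, and a branch has two distinct ends, so at least one
  entry 1 or -1 survives.\<close>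

lemma branch_vec_nonzero:
  assumes "e < Ne"
  shows "branch_vec G Nn Ne slack e \<noteq> 0\<^sub>v (Nn - 1)"
proof
  assume zero: "branch_vec G Nn Ne slack e = 0\<^sub>v (Nn - 1)"
  have E0: "E $$ (i, e) = 0" if "i < Nn - 1" for i
  proof -
    have "branch_vec G Nn Ne slack e $ i = E $$ (i, e)"
      using that assms E_carrier by (auto simp: branch_vec_def)
    then show ?thesis using zero that by simp
  qed
  obtain k where k: "k = tail G e \<or> k = head G e" "k < Nn" "k \<noteq> slack"
    using arc_ends[OF assms] by metis
  have "insert_index slack (delete_index slack k) = k"
    using k by (simp add: insert_index_eq_iff)
  then show False
    using E0[OF delete_index_less[OF k(2,3)]] index_E[OF delete_index_less[OF k(2,3)] assms]
      k arc_ends(3)[OF assms] by auto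
qed

end

text \<open>As \<open>mat_inv\<close>, \<open>Lim\<close> and \<open>inverse\<close> are total, the
  conjuncts before the formula certify that the inverses and the limit exist and that the bracket is
  non-zero.\<close>

theorem lemma1:
  fixes G :: "(nat, nat) pre_digraph" and Nn Ne slack s :: nat and b :: "nat \<Rightarrow> real"
    and Bo Bc_inv :: "real mat" and \<nu> :: "real vec"
  assumes grid: "power_grid G Nn Ne slack s b"
    and conn: "connected_open G s"
    and Bo: "Bo = open_laplacian G Nn Ne slack s b"
    and nu: "\<nu> = branch_vec G Nn Ne slack s"
    and Bc_inv: "Bc_inv = closed_inverse G Nn Ne slack s b"
  shows "invertible_mat Bo
    \<and> (\<forall>bs>0. invertible_mat (closed_laplacian G Nn Ne slack s b bs))
    \<and> (\<forall>i<Nn - 1. \<forall>j<Nn - 1.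
          ((\<lambda>bs. mat_inv (closed_laplacian G Nn Ne slack s b bs) $$ (i, j))
             \<longlongrightarrow> Bc_inv $$ (i, j)) at_top)
    \<and> \<nu> \<bullet> ((Bo - Bo * Bc_inv * Bo) *\<^sub>v \<nu>) \<noteq> 0
    \<and> mat_inv Bo = Bc_inv +
         inverse (\<nu> \<bullet> ((Bo - Bo * Bc_inv * Bo) *\<^sub>v \<nu>)) \<cdot>\<^sub>m
           ((1\<^sub>m (Nn - 1) - Bc_inv * Bo) * outer \<nu> \<nu> * (1\<^sub>m (Nn - 1) - Bo * Bc_inv))"
proof -
  interpret power_grid G Nn Ne slack s b by (rule grid)
  interpret L: sym_pos_def "Nn - 1" Bo \<nu>
    using pos_def_open_laplacian[OF conn] transpose_open_laplacian branch_vec_carrier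
      branch_vec_nonzero[of s] coupler arcs_eq
    by unfold_locales (auto simp: Bo nu)
  have closed: "closed_laplacian G Nn Ne slack s b t = Bo + t \<cdot>\<^sub>m outer \<nu> \<nu>" for t
    by (simp add: closed_laplacian_def Bo nu)
  \<comment> \<open>Convergence was shown entrywise, and limits along \<open>at_top\<close> are
    unique, so \<open>Lim\<close> returns the entries of \<open>L.C\<close>.\<close>
  have Bc: "Bc_inv = L.C"
    unfolding Bc_inv closed_inverse_def closed
    using L.C_carrier L.closed_limit by (intro eq_matI) (auto intro!: tendsto_Lim)
  have "invertible_mat Bo"
    by (rule invertible_mat_det[OF L.A_carrier pos_def_det[OF L.pos_def]])
  moreover have "invertible_mat (Bo + t \<cdot>\<^sub>m outer \<nu> \<nu>)" if "t > 0" for t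
    using pos_def_add_outer[OF L.pos_def L.v(1), of t] that
    by (intro invertible_mat_det[of _ "Nn - 1"] pos_def_det) (auto simp: pos_def_def)
  moreover have "\<nu> \<bullet> ((Bo - Bo * L.C * Bo) *\<^sub>v \<nu>) \<noteq> 0"
    unfolding L.denominator using L.vv_pos L.q_pos by simp
  ultimately show ?thesis
    using L.closed_limit L.inverse_eq unfolding closed Bc by blast
qed

end
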